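(* Consider the CapLease protocol (defined in the context). Assume: (i) canonicalization and trusted metadata are correct; (ii) confirmation identifiers are stable, i.e. retries of the same confirmation challenge return the same confirmation event $e_u$; (iii) the ledger is durable, non-rollback and linearizable; (iv) principals and manifests are authenticated. Then CapLease satisfies bounded issuance and bounded admission: for every execution trace $\tau$ of the protocol and every authorization instance $\alpha=(\sigma,e_u,b)$, $$N_{\mathrm{issue}}(\alpha,\tau)\le b \qquad\text{and}\qquad N_{\mathrm{admit}}(\alpha,\tau)\le b .$$ If, in addition, the external sink enforces idempotency over the keys $k$ (all invocations carrying the same key $k$ together produce at most one external effect), then CapLease also satisfies bounded effects: for every such $\tau$ and $\alpha$, $$N_{\mathrm{effect}}(\alpha,\tau)\le b .$$
   Context: **Calls and identities.** An agent proposes a call $c=(\mathsf{tool},\mathsf{args})$, which an upstream authority mechanism evaluates against trusted context $\gamma$. The action identity is $\sigma(c,\gamma)=(P_u,h_c,h_a,R)$, where $P_u$ is the user principal, $h_c$ and $h_a$ bind the canonical operation and the complete arguments, and $R$ is the target resource. Canonicalization is correct if effect-equivalent calls receive the same identity and calls with security-relevant differences receive different identities; ambiguous calls are rejected. The execution context is $\chi=(P_e,S,T,v_p,v_s)$ (executor, session, task, policy epoch, schema epoch); it restricts where and by whom an authorization may be used, but is not part of the action identity. A confirmation event $e_u$ is an authenticated user confirmation bound to the displayed action, the principal $P_u$ and a budget $b$ (a positive integer). An authorization instance is $\alpha=(\sigma,e_u,b)$. **Adversary.** Requests may be repeated, concurrent, replayed, delegated, or interrupted by crashes and lost acknowledgements.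 Authorization objects may be copied and presented by other principals. The adversary cannot forge authenticated principals, confirmation events, provenance records, policy epochs, tool contracts, or committed ledger transitions. **Ledger and records.** For an approved call, the ledger holds a record $r_\alpha=(\sigma,e_u,b,\chi,t_i,t_e,\nu)$, where $[t_i,t_e]$ is the validity interval and $\nu$ is a stable record identifier. The ledger enforces uniqueness over $(\sigma,e_u)$. A record has at most $b$ independently consumable slots, indexed by $j$. The manifest given to the executor is $m=(\sigma,e_u,b,\chi,t_i,t_e,\nu,\mu)$, where $\mu$ authenticates all preceding fields; modifying any field invalidates $\mu$. The manifest represents the ledger record and does not itself create authority. **CapLease transitions.** Slots move $\textsc{Issued}\to\textsc{Prepared}\to\textsc{Committed}$, or $\textsc{Issued}\to\textsc{Revoked}$. All transitions are ordered by the ledger. - *Issue*: in one transaction, recompute $\sigma$ from the trusted contract and complete arguments, verify that $e_u$ binds $\sigma$, $P_u$ and $b$, validate $\chi$, and insert the record for $(\sigma,e_u)$ if none exists (its slots being $\textsc{Issued}$); otherwise return the existing record, with no new budget. Changing the executor, session or contract version does not create another record for the same $(\sigma,e_u)$. - *Prepare*: after the executor verifies the manifest, principal, validity interval, action identity and epochs, a linearizable compare-and-swap that succeeds only on an unrevoked $\textsc{Issued}$ slot, moves it to $\textsc{Prepared}$, and allocates the key $k=H(\nu\parallel j\parallel \mathsf{tool})$, where $H$ is a fixed hash function and $\parallel$ is concatenation. - *Invoke*: only after a slot is $\textsc{Prepared}$, the executor invokes the canonical call at the external tool (the sink), passing that slot's key $k$. Calls with mismatched arguments, principals, resources or epochs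 are rejected. - *Commit*: a $\textsc{Prepared}$ slot becomes $\textsc{Committed}$ on a tool receipt containing the matching $k$. - *Revoke*: moves an $\textsc{Issued}$ slot to $\textsc{Revoked}$. - *Recover*: resumes an existing $\textsc{Prepared}$ slot, re-invoking with the same $k$; the slot remains $\textsc{Prepared}$ or becomes $\textsc{Committed}$. - *Delegate*: creates an authenticated child execution context under the same authorization instance, which may narrow the executor, scope, budget or expiry but cannot change $\sigma$ or $e_u$. Creating the child consumes or reserves parent budget, so parent and child cannot independently exercise the same authorization. **Counts.** For an execution trace $\tau$ (a finite sequence of protocol events), $N_{\mathrm{issue}}(\alpha,\tau)$ is the number of authorization slots made available for $\alpha$; $N_{\mathrm{admit}}(\alpha,\tau)$ is the number of slots for $\alpha$ admitted for execution, i.e. successful preparations; and $N_{\mathrm{effect}}(\alpha,\tau)$ is the number of externally materialized effects for $\alpha$, i.e. effects at the sink from invocations for slots of $\alpha$. *)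

theory Defs
  imports Main
begin

text \<open>Names, digests, authenticators and keys are finite strings; clock values and epochs are
  natural numbers. Type variables: \<open>'a\<close> tool arguments, \<open>'g\<close> trusted contexts,
  \<open>'m\<close> tool contracts, \<open>'s\<close> physical states of the ledger service.\<close>

type_synonym principal = string
type_synonym tool = string
type_synonym rec_id = string
type_synonym key = string
type_synonym 'a call = "tool \<times> 'a"

record identity =
  id_user :: principal
  id_op :: string
  id_args :: string
  id_res :: string

record exec_ctx =
  x_executor :: principal
  x_session :: string
  x_task :: string
  x_policy :: nat
  x_schema :: nat

record confirmation =
  ce_id :: string
  ce_action :: identity
  ce_user :: principal
  ce_budget :: nat

type_synonym instance_id = "identity \<times> confirmation \<times> nat"

definition budget :: "instance_id \<Rightarrow> nat" where
  "budget \<alpha> = snd (snd \<alpha>)"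

text \<open>The ledger record and the manifest without its authenticator have the same fields. Child
  contexts are described by the same type: they keep action, confirmation and record identifier,
  and their \<open>r_budget\<close> is the part of the budget reserved for them.\<close>

record grant =
  r_action :: identity
  r_conf :: confirmation
  r_budget :: nat
  r_ctx :: exec_ctx
  r_from :: nat
  r_until :: nat
  r_id :: rec_id

type_synonym manifest = "grant \<times> string"

definition instance_of :: "grant \<Rightarrow> instance_id" where
  "instance_of r = (r_action r, r_conf r, r_budget r)"

datatype slot_state = Issued | Prepared key | Committed key | Revoked

text \<open>A slot is addressed by record identifier and index. Its holder is the record itself, or the
  child context for which delegation has reserved the slot.\<close>

record ledger =
  records :: "rec_id \<rightharpoonup> grant"
  slots :: "rec_id \<times> nat \<rightharpoonup> slot_state \<times> grant"

definition empty_ledger :: ledger where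
  "empty_ledger = \<lparr>records = Map.empty, slots = Map.empty\<rparr>"

text \<open>Everything the protocol depends on but does not itself define.
  \<^item> \<open>registry\<close> and \<open>ctx_accepted\<close> are the metadata the authority uses as trusted;
    \<open>genuine_contract\<close> and \<open>ctx_genuine\<close> are the actual ones. The schema epoch is the contract
    version. \<open>canon\<close> yields \<open>None\<close> on rejected calls.
  \<^item> \<open>answer ch n\<close> is the outcome of the \<open>n\<close>-th attempt at the confirmation challenge \<open>ch\<close>.
  \<^item> \<open>accepts_principal p q\<close>: authentication lets the actor \<open>p\<close> act as \<open>q\<close>.
  \<^item> \<open>forgeable M m\<close>: from the manifests \<open>M\<close> in circulation, the adversary can construct \<open>m\<close>.
  \<^item> \<open>ledger_read st v\<close>: in the physical state \<open>st\<close>, a read may return \<open>v\<close>.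
    \<open>ledger_txn st v v' st'\<close>: in \<open>st\<close>, a transaction may be executed that observes \<open>v\<close> and replaces
    it by \<open>v'\<close>, leading to \<open>st'\<close>. \<open>ledger_crash\<close> and \<open>ledger_maint\<close> are the state changes that
    crashes, and replica takeover, restoring and the like, may cause. \<open>ledger_content\<close> is the
    committed content.\<close>

record ('a, 'g, 'm, 's) env =
  canon :: "'m \<Rightarrow> 'a call \<Rightarrow> 'g \<Rightarrow> identity option"
  registry :: "tool \<Rightarrow> nat \<Rightarrow> 'm"
  genuine_contract :: "tool \<Rightarrow> nat \<Rightarrow> 'm"
  ctx_accepted :: "'g \<Rightarrow> bool"
  ctx_genuine :: "'g \<Rightarrow> bool"
  effect_equiv :: "'a call \<times> 'g \<Rightarrow> 'a call \<times> 'g \<Rightarrow> bool"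
  security_diff :: "'a call \<times> 'g \<Rightarrow> 'a call \<times> 'g \<Rightarrow> bool"
  ambiguous :: "'a call \<times> 'g \<Rightarrow> bool"
  answer :: "string \<Rightarrow> nat \<Rightarrow> confirmation option"
  ctx_admissible :: "exec_ctx \<Rightarrow> bool"
  executor_narrows :: "principal \<Rightarrow> principal \<Rightarrow> bool"
  scope_narrows :: "string \<times> string \<Rightarrow> string \<times> string \<Rightarrow> bool"
  accepts_principal :: "principal \<Rightarrow> principal \<Rightarrow> bool"
  auth_tag :: "grant \<Rightarrow> string"
  verifies :: "manifest \<Rightarrow> bool"
  forgeable :: "manifest set \<Rightarrow> manifest \<Rightarrow> bool"
  hash :: "string \<Rightarrow> key"
  encode_index :: "nat \<Rightarrow> string"
  ledger_content :: "'s \<Rightarrow> ledger"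
  ledger_read :: "'s \<Rightarrow> ledger \<Rightarrow> bool"
  ledger_txn :: "'s \<Rightarrow> ledger \<Rightarrow> ledger \<Rightarrow> 's \<Rightarrow> bool"
  ledger_crash :: "'s \<Rightarrow> 's \<Rightarrow> bool"
  ledger_maint :: "'s \<Rightarrow> 's \<Rightarrow> bool"

definition canonicalization_correct :: "('a, 'g, 'm, 's) env \<Rightarrow> bool" where
  "canonicalization_correct E \<longleftrightarrow>
    (\<forall>c \<gamma> v c' \<gamma>' v'. ctx_genuine E \<gamma> \<longrightarrow> ctx_genuine E \<gamma>' \<longrightarrow>
      (let i = canon E (genuine_contract E (fst c) v) c \<gamma>;
           i' = canon E (genuine_contract E (fst c') v') c' \<gamma>'
       in (effect_equiv E (c, \<gamma>) (c', \<gamma>') \<longrightarrow> \<not> ambiguous E (c, \<gamma>) \<longrightarrow> \<not> ambiguous E (c', \<gamma>')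
             \<longrightarrow> (\<exists>\<sigma>. i = Some \<sigma> \<and> i' = Some \<sigma>)) \<and>
          (security_diff E (c, \<gamma>) (c', \<gamma>') \<longrightarrow> (\<forall>\<sigma>. \<not> (i = Some \<sigma> \<and> i' = Some \<sigma>))) \<and>
          (ambiguous E (c, \<gamma>) \<longrightarrow> i = None)))"

definition trusted_metadata_correct :: "('a, 'g, 'm, 's) env \<Rightarrow> bool" where
  "trusted_metadata_correct E \<longleftrightarrow>
    registry E = genuine_contract E \<and> (\<forall>\<gamma>. ctx_accepted E \<gamma> \<longrightarrow> ctx_genuine E \<gamma>)"

definition confirmations_stable :: "('a, 'g, 'm, 's) env \<Rightarrow> bool" where
  "confirmations_stable E \<longleftrightarrow>
    (\<forall>ch n n' e e'. answer E ch n = Some e \<longrightarrow> answer E ch n' = Some e' \<longrightarrow> e = e')"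

definition ledger_durable :: "('a, 'g, 'm, 's) env \<Rightarrow> bool" where
  "ledger_durable E \<longleftrightarrow>
    (\<forall>st st'. ledger_crash E st st' \<longrightarrow> ledger_content E st' = ledger_content E st)"

definition ledger_non_rollback :: "('a, 'g, 'm, 's) env \<Rightarrow> bool" where
  "ledger_non_rollback E \<longleftrightarrow>
    (\<forall>st st'. ledger_maint E st st' \<longrightarrow> ledger_content E st' = ledger_content E st)"

text \<open>Traces list ledger operations by the point at which they take effect. Linearizability says
  that there each operation acts atomically on the current content; without it, an operation may
  act on a stale or partial view.\<close>

definition ledger_linearizable :: "('a, 'g, 'm, 's) env \<Rightarrow> bool" where
  "ledger_linearizable E \<longleftrightarrow>
    (\<forall>st v. ledger_read E st v \<longrightarrow> v = ledger_content E st) \<and>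
    (\<forall>st v v' st'. ledger_txn E st v v' st' \<longrightarrow>
        v = ledger_content E st \<and> ledger_content E st' = v')"

definition principals_authenticated :: "('a, 'g, 'm, 's) env \<Rightarrow> bool" where
  "principals_authenticated E \<longleftrightarrow> (\<forall>p q. accepts_principal E p q \<longrightarrow> p = q)"

definition manifests_authenticated :: "('a, 'g, 'm, 's) env \<Rightarrow> bool" where
  "manifests_authenticated E \<longleftrightarrow>
    (\<forall>r. verifies E (r, auth_tag E r)) \<and>
    (\<forall>r r' \<mu>. verifies E (r, \<mu>) \<longrightarrow> verifies E (r', \<mu>) \<longrightarrow> r = r') \<and>
    (\<forall>M m. forgeable E M m \<longrightarrow> verifies E m \<longrightarrow> m \<in> M)"

text \<open>A trace lists the events that occur, each atomic; concurrency, replay and retries are arbitrary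
  interleavings and repetitions. In events, \<open>p\<close> is the acting principal and \<open>q\<close> the principal it claims to be. \<open>Issue\<close> inserts
  a record with the set \<open>J\<close> of its slots, \<open>Return_Existing\<close> is the other outcome of an issue
  request. \<open>Recover\<close> has a flag telling whether the slot becomes committed. \<open>Effect\<close> is one
  external effect materialized by the sink for an earlier invocation, \<open>Receipt\<close> a tool receipt.
  \<open>Refused\<close> is any rejected request. Lost acknowledgements need no event: no step waits for one.\<close>

datatype ('a, 'g) event =
    Confirm string nat
  | Issue "'a call" 'g grant "nat set"
  | Return_Existing "'a call" 'g confirmation exec_ctx grant
  | Delegate principal principal manifest grant "nat set"
  | Prepare principal principal manifest "'a call" 'g nat key
  | Invoke principal principal "'a call" 'g rec_id nat key
  | Recover principal principal "'a call" 'g rec_id nat key bool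
  | Commit rec_id nat key
  | Revoke rec_id nat
  | Effect rec_id nat key
  | Receipt key
  | Advance nat nat nat
  | Crash
  | Maintenance
  | Refused

record 's state =
  store :: 's
  now :: nat
  policy_epoch :: nat
  schema_epoch :: nat
  confirmed :: "confirmation set"
  manifests :: "manifest set"
  invoked :: "(rec_id \<times> nat \<times> key) set"
  receipts :: "key set"

definition action_identity ::
  "('a, 'g, 'm, 's) env \<Rightarrow> nat \<Rightarrow> 'a call \<Rightarrow> 'g \<Rightarrow> identity option" where
  "action_identity E v c \<gamma> =
    (if ctx_accepted E \<gamma> then canon E (registry E (fst c) v) c \<gamma> else None)"

definition epochs_current :: "'s state \<Rightarrow> exec_ctx \<Rightarrow> bool" where
  "epochs_current s \<chi> \<longleftrightarrow> x_policy \<chi> = policy_epoch s \<and> x_schema \<chi> = schema_epoch s"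

definition issue_ok ::
  "('a, 'g, 'm, 's) env \<Rightarrow> 's state \<Rightarrow> 'a call \<Rightarrow> 'g \<Rightarrow> identity \<Rightarrow> confirmation \<Rightarrow> exec_ctx \<Rightarrow> bool" where
  "issue_ok E s c \<gamma> \<sigma> e \<chi> \<longleftrightarrow>
    action_identity E (x_schema \<chi>) c \<gamma> = Some \<sigma> \<and>
    e \<in> confirmed s \<and> ce_action e = \<sigma> \<and> ce_user e = id_user \<sigma> \<and> 0 < ce_budget e \<and>
    epochs_current s \<chi> \<and> ctx_admissible E \<chi>"

definition manifest_ok ::
  "('a, 'g, 'm, 's) env \<Rightarrow> 's state \<Rightarrow> principal \<Rightarrow> principal \<Rightarrow> manifest \<Rightarrow> bool" where
  "manifest_ok E s p q m \<longleftrightarrow>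
    (m \<in> manifests s \<or> forgeable E (manifests s) m) \<and> verifies E m \<and>
    accepts_principal E p q \<and> q = x_executor (r_ctx (fst m)) \<and>
    r_from (fst m) \<le> now s \<and> now s \<le> r_until (fst m) \<and>
    epochs_current s (r_ctx (fst m))"

definition call_ok ::
  "('a, 'g, 'm, 's) env \<Rightarrow> 's state \<Rightarrow> principal \<Rightarrow> principal \<Rightarrow> 'a call \<Rightarrow> 'g \<Rightarrow> grant \<Rightarrow> bool" where
  "call_ok E s p q c \<gamma> h \<longleftrightarrow>
    accepts_principal E p q \<and> q = x_executor (r_ctx h) \<and>
    action_identity E (x_schema (r_ctx h)) c \<gamma> = Some (r_action h) \<and>
    epochs_current s (r_ctx h)"

definition narrows :: "('a, 'g, 'm, 's) env \<Rightarrow> grant \<Rightarrow> grant \<Rightarrow> bool" where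
  "narrows E h r \<longleftrightarrow>
    r_action h = r_action r \<and> r_conf h = r_conf r \<and> r_id h = r_id r \<and>
    r_budget h \<le> r_budget r \<and> r_from r \<le> r_from h \<and> r_until h \<le> r_until r \<and>
    executor_narrows E (x_executor (r_ctx h)) (x_executor (r_ctx r)) \<and>
    scope_narrows E (x_session (r_ctx h), x_task (r_ctx h)) (x_session (r_ctx r), x_task (r_ctx r)) \<and>
    x_policy (r_ctx h) = x_policy (r_ctx r) \<and> x_schema (r_ctx h) = x_schema (r_ctx r)"

definition add_record :: "grant \<Rightarrow> nat set \<Rightarrow> ledger \<Rightarrow> ledger" where
  "add_record r J v =
    \<lparr>records = (records v)(r_id r \<mapsto> r),
     slots = (\<lambda>x. if fst x = r_id r \<and> snd x \<in> J then Some (Issued, r) else slots v x)\<rparr>"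

definition set_slot :: "rec_id \<Rightarrow> nat \<Rightarrow> slot_state \<Rightarrow> grant \<Rightarrow> ledger \<Rightarrow> ledger" where
  "set_slot \<nu> j a h v = v\<lparr>slots := (slots v)((\<nu>, j) \<mapsto> (a, h))\<rparr>"

definition reserve :: "rec_id \<Rightarrow> nat set \<Rightarrow> grant \<Rightarrow> ledger \<Rightarrow> ledger" where
  "reserve \<nu> J h v =
    v\<lparr>slots := (\<lambda>x. if fst x = \<nu> \<and> snd x \<in> J then Some (Issued, h) else slots v x)\<rparr>"

inductive step :: "('a, 'g, 'm, 's) env \<Rightarrow> 's state \<Rightarrow> ('a, 'g) event \<Rightarrow> 's state \<Rightarrow> bool"
  for E :: "('a, 'g, 'm, 's) env" and s :: "'s state" where
  confirm: "answer E ch n = Some e \<Longrightarrow>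
    step E s (Confirm ch n) (s\<lparr>confirmed := insert e (confirmed s)\<rparr>)"
| issue: "\<lbrakk>issue_ok E s c \<gamma> (r_action r) (r_conf r) (r_ctx r);
    r_budget r = ce_budget (r_conf r);
    ledger_txn E (store s) v (add_record r J v) st;
    \<forall>r' \<in> ran (records v). (r_action r', r_conf r') \<noteq> (r_action r, r_conf r);
    r_id r \<notin> dom (records v); J \<subseteq> {1..r_budget r}\<rbrakk> \<Longrightarrow>
    step E s (Issue c \<gamma> r J)
      (s\<lparr>store := st, manifests := insert (r, auth_tag E r) (manifests s)\<rparr>)"
| return_existing: "\<lbrakk>issue_ok E s c \<gamma> (r_action r) e \<chi>;
    ledger_read E (store s) v; r \<in> ran (records v); r_conf r = e\<rbrakk> \<Longrightarrow>
    step E s (Return_Existing c \<gamma> e \<chi> r)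
      (s\<lparr>manifests := insert (r, auth_tag E r) (manifests s)\<rparr>)"
| delegate: "\<lbrakk>manifest_ok E s p q m; narrows E h (fst m);
    J \<noteq> {}; finite J; r_budget h = card J;
    ledger_txn E (store s) v (reserve (r_id h) J h v) st;
    \<forall>j\<in>J. slots v (r_id h, j) = Some (Issued, fst m)\<rbrakk> \<Longrightarrow>
    step E s (Delegate p q m h J)
      (s\<lparr>store := st, manifests := insert (h, auth_tag E h) (manifests s)\<rparr>)"
| prepare: "\<lbrakk>manifest_ok E s p q m; call_ok E s p q c \<gamma> (fst m);
    \<nu> = r_id (fst m); k = hash E (\<nu> @ encode_index E j @ fst c);
    ledger_txn E (store s) v (set_slot \<nu> j (Prepared k) (fst m) v) st;
    slots v (\<nu>, j) = Some (Issued, fst m)\<rbrakk> \<Longrightarrow>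
    step E s (Prepare p q m c \<gamma> j k) (s\<lparr>store := st\<rparr>)"
| invoke: "\<lbrakk>ledger_read E (store s) v; slots v (\<nu>, j) = Some (Prepared k, h);
    call_ok E s p q c \<gamma> h\<rbrakk> \<Longrightarrow>
    step E s (Invoke p q c \<gamma> \<nu> j k) (s\<lparr>invoked := insert (\<nu>, j, k) (invoked s)\<rparr>)"
| recover: "\<lbrakk>ledger_read E (store s) v; slots v (\<nu>, j) = Some (Prepared k, h);
    call_ok E s p q c \<gamma> h\<rbrakk> \<Longrightarrow>
    step E s (Recover p q c \<gamma> \<nu> j k False) (s\<lparr>invoked := insert (\<nu>, j, k) (invoked s)\<rparr>)"
| recover_commit: "\<lbrakk>ledger_txn E (store s) v (set_slot \<nu> j (Committed k) h v) st;
    slots v (\<nu>, j) = Some (Prepared k, h); call_ok E s p q c \<gamma> h; k \<in> receipts s\<rbrakk> \<Longrightarrow>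
    step E s (Recover p q c \<gamma> \<nu> j k True)
      (s\<lparr>store := st, invoked := insert (\<nu>, j, k) (invoked s)\<rparr>)"
| commit: "\<lbrakk>ledger_txn E (store s) v (set_slot \<nu> j (Committed k) h v) st;
    slots v (\<nu>, j) = Some (Prepared k, h); k \<in> receipts s\<rbrakk> \<Longrightarrow>
    step E s (Commit \<nu> j k) (s\<lparr>store := st\<rparr>)"
| revoke: "\<lbrakk>ledger_txn E (store s) v (set_slot \<nu> j Revoked h v) st;
    slots v (\<nu>, j) = Some (Issued, h)\<rbrakk> \<Longrightarrow>
    step E s (Revoke \<nu> j) (s\<lparr>store := st\<rparr>)"
| effect: "(\<nu>, j, k) \<in> invoked s \<Longrightarrow> step E s (Effect \<nu> j k) s"
| receipt: "(\<nu>, j, k) \<in> invoked s \<Longrightarrow>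
    step E s (Receipt k) (s\<lparr>receipts := insert k (receipts s)\<rparr>)"
| advance: "\<lbrakk>now s \<le> t; policy_epoch s \<le> vp; schema_epoch s \<le> vs\<rbrakk> \<Longrightarrow>
    step E s (Advance t vp vs) (s\<lparr>now := t, policy_epoch := vp, schema_epoch := vs\<rparr>)"
| crash: "ledger_crash E (store s) st \<Longrightarrow> step E s Crash (s\<lparr>store := st\<rparr>)"
| maintenance: "ledger_maint E (store s) st \<Longrightarrow> step E s Maintenance (s\<lparr>store := st\<rparr>)"
| refused: "step E s Refused s"

definition initial :: "('a, 'g, 'm, 's) env \<Rightarrow> 's state \<Rightarrow> bool" where
  "initial E s \<longleftrightarrow> ledger_content E (store s) = empty_ledger \<and>
    confirmed s = {} \<and> manifests s = {} \<and> invoked s = {} \<and> receipts s = {}"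

inductive run :: "('a, 'g, 'm, 's) env \<Rightarrow> ('a, 'g) event list \<Rightarrow> 's state \<Rightarrow> bool"
  for E :: "('a, 'g, 'm, 's) env" where
  start: "initial E s \<Longrightarrow> run E [] s"
| extend: "run E \<tau> s \<Longrightarrow> step E s ev s' \<Longrightarrow> run E (\<tau> @ [ev]) s'"

definition caplease_trace :: "('a, 'g, 'm, 's) env \<Rightarrow> ('a, 'g) event list \<Rightarrow> bool" where
  "caplease_trace E \<tau> \<longleftrightarrow> (\<exists>s. run E \<tau> s)"

text \<open>Slots belong to the authorization instance with which their record was inserted, no matter
  to which child context they have been delegated.\<close>

definition record_of :: "instance_id \<Rightarrow> ('a, 'g) event list \<Rightarrow> rec_id \<Rightarrow> bool" where
  "record_of \<alpha> \<tau> \<nu> \<longleftrightarrow>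
    (\<exists>c \<gamma> r J. Issue c \<gamma> r J \<in> set \<tau> \<and> instance_of r = \<alpha> \<and> r_id r = \<nu>)"

definition N_issue :: "instance_id \<Rightarrow> ('a, 'g) event list \<Rightarrow> nat" where
  "N_issue \<alpha> \<tau> = (\<Sum>ev\<leftarrow>\<tau>. case ev of
      Issue c \<gamma> r J \<Rightarrow> (if instance_of r = \<alpha> then card J else 0)
    | _ \<Rightarrow> 0)"

definition N_admit :: "instance_id \<Rightarrow> ('a, 'g) event list \<Rightarrow> nat" where
  "N_admit \<alpha> \<tau> = length (filter (\<lambda>ev. case ev of
      Prepare p q m c \<gamma> j k \<Rightarrow> record_of \<alpha> \<tau> (r_id (fst m))
    | _ \<Rightarrow> False) \<tau>)"

definition N_effect :: "instance_id \<Rightarrow> ('a, 'g) event list \<Rightarrow> nat" where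
  "N_effect \<alpha> \<tau> = length (filter (\<lambda>ev. case ev of
      Effect \<nu> j k \<Rightarrow> record_of \<alpha> \<tau> \<nu>
    | _ \<Rightarrow> False) \<tau>)"

definition sink_idempotent :: "('a, 'g) event list \<Rightarrow> bool" where
  "sink_idempotent \<tau> \<longleftrightarrow>
    (\<forall>k. length (filter (\<lambda>ev. case ev of Effect \<nu> j k' \<Rightarrow> k' = k | _ \<Rightarrow> False) \<tau>) \<le> 1)"

end

theory Submission
  imports Defs
begin

text \<open>Committed ledger content only grows: records are never removed, and a slot that has been
  prepared keeps its key for ever, since no transition leads from \<^const>\<open>Prepared\<close> or
  \<^const>\<open>Committed\<close> back to \<^const>\<open>Issued\<close>. As \<open>(\<sigma>, e\<^sub>u)\<close> determines the record, all slots of an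
  instance with budget \<open>b\<close> lie in \<open>{\<nu>} \<times> {1..b}\<close> for a single \<open>\<nu>\<close>. Preparations are injective
  into these slots; under an idempotent sink, so are effects, because different effects
  carry different keys and hence come from different slots. Collisions of the hash function
  therefore do no harm.\<close>

section \<open>Growth of the ledger content under single updates\<close>

text \<open>Forgets the holder and identifies \<open>Prepared k\<close> with
  \<open>Committed k\<close>, so that a commit changes nothing here and the map can only grow along
  a run.\<close>

definition slot_key :: "ledger \<Rightarrow> rec_id \<times> nat \<rightharpoonup> key" where
  "slot_key L x = (case slots L x of
      Some (Prepared k, h) \<Rightarrow> Some k
    | Some (Committed k, h) \<Rightarrow> Some k
    | _ \<Rightarrow> None)"

text \<open>The injectivity is the ledger's uniqueness over \<open>(\<sigma>, e\<^sub>u)\<close>.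
  The budget is left out of the pair, so two records that differ only in budget are excluded as
  well.\<close>

definition well_formed :: "ledger \<Rightarrow> bool" where
  "well_formed L \<longleftrightarrow>
    (\<forall>\<nu> r. records L \<nu> = Some r \<longrightarrow> r_id r = \<nu>) \<and>
    inj_on (\<lambda>r. (r_action r, r_conf r)) (ran (records L)) \<and>
    (\<forall>\<nu> j y. slots L (\<nu>, j) = Some y \<longrightarrow> (\<exists>r. records L \<nu> = Some r \<and> j \<in> {1..r_budget r}))"

text \<open>Preservation of \<open>well_formed\<close> enters as an implication, so the relation is
  reflexive on all ledgers; this settles every step that leaves the content alone.\<close>

definition extends :: "ledger \<Rightarrow> ledger \<Rightarrow> bool" where
  "extends L L' \<longleftrightarrow>
    records L \<subseteq>\<^sub>m records L' \<and> slot_key L \<subseteq>\<^sub>m slot_key L' \<and> (well_formed L \<longrightarrow> well_formed L')"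

lemma extends_refl [simp]: "extends L L"
  by (simp add: extends_def)

lemma slot_key_SomeD: "slot_key L x = Some k \<Longrightarrow> \<exists>y. slots L x = Some y"
  by (auto simp: slot_key_def split: option.splits)

lemma well_formed_empty: "well_formed empty_ledger"
  by (simp add: well_formed_def empty_ledger_def)

lemma slot_key_mono:
  assumes "\<And>x k. slot_key L x = Some k \<Longrightarrow> slots L' x = slots L x \<or> slot_key L' x = Some k"
  shows "slot_key L \<subseteq>\<^sub>m slot_key L'"
  unfolding map_le_def
proof
  fix x assume "x \<in> dom (slot_key L)"
  then obtain k where k: "slot_key L x = Some k"
    by blast
  from assms [OF this] k show "slot_key L x = slot_key L' x"
    by (auto simp: slot_key_def)
qed

text \<open>Well-formedness sees slots only through the set of occupied addresses, so an update that
  opens no new address preserves it, whatever states and holders it writes.\<close>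

lemma extends_slots:
  assumes "records L' = records L"
    and "\<And>x. slots L' x \<noteq> None \<Longrightarrow> slots L x \<noteq> None"
    and "\<And>x k. slot_key L x = Some k \<Longrightarrow> slots L' x = slots L x \<or> slot_key L' x = Some k"
  shows "extends L L'"
proof -
  have "well_formed L'" if wf: "well_formed L"
  proof -
    have "\<exists>y. slots L x = Some y" if "slots L' x = Some y'" for x y'
      using assms(2) [of x] that by auto
    with wf show ?thesis
      unfolding well_formed_def assms(1) by meson
  qed
  with slot_key_mono [of L L', OF assms(3)] show ?thesis
    by (simp add: extends_def assms(1))
qed

lemma extends_set_slot:
  assumes "slots L (\<nu>, j) = Some (b, h')"
    and "\<And>k. slot_key L (\<nu>, j) = Some k \<Longrightarrow> a = Prepared k \<or> a = Committed k"
  shows "extends L (set_slot \<nu> j a h L)"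
proof (rule extends_slots)
  show "slots (set_slot \<nu> j a h L) x = slots L x \<or> slot_key (set_slot \<nu> j a h L) x = Some k"
    if "slot_key L x = Some k" for x k
    using that assms(2) [of k] by (cases "x = (\<nu>, j)") (auto simp: set_slot_def slot_key_def)
qed (use assms(1) in \<open>auto simp: set_slot_def split: if_splits\<close>)

lemma extends_reserve:
  assumes "\<forall>j\<in>J. slots L (\<nu>, j) = Some (Issued, r)"
  shows "extends L (reserve \<nu> J h L)"
proof (rule extends_slots)
  show "slots (reserve \<nu> J h L) x = slots L x \<or> slot_key (reserve \<nu> J h L) x = Some k"
    if "slot_key L x = Some k" for x k
    using that assms by (cases x) (auto simp: reserve_def slot_key_def)
qed (use assms in \<open>auto simp: reserve_def split: if_splits\<close>)

text \<open>In a well-formed ledger a fresh identifier has no slots yet, so the insertion overwrites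
  none and no key is lost.\<close>

lemma extends_add_record:
  assumes new: "\<forall>r' \<in> ran (records L). (r_action r', r_conf r') \<noteq> (r_action r, r_conf r)"
    and fresh: "r_id r \<notin> dom (records L)" and J: "J \<subseteq> {1..r_budget r}" and wf: "well_formed L"
  shows "extends L (add_record r J L)"
proof -
  let ?L' = "add_record r J L"
  have no_slot: "slots L (r_id r, j) = None" for j
    using wf fresh by (force simp: well_formed_def)
  have "slot_key L \<subseteq>\<^sub>m slot_key ?L'"
  proof (rule slot_key_mono)
    fix x k assume "slot_key L x = Some k"
    with no_slot have "fst x \<noteq> r_id r"
      by (cases x) (auto dest: slot_key_SomeD)
    then show "slots ?L' x = slots L x \<or> slot_key ?L' x = Some k"
      by (simp add: add_record_def)
  qed
  moreover have "records L \<subseteq>\<^sub>m records ?L'"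
    using fresh by (auto simp: add_record_def map_le_def)
  moreover have "well_formed ?L'"
  proof -
    have "ran (records ?L') = insert r (ran (records L))"
      using fresh by (simp add: add_record_def domIff ran_map_upd)
    moreover have "inj_on (\<lambda>r. (r_action r, r_conf r)) (insert r (ran (records L)))"
      using new wf by (auto simp: well_formed_def)
    moreover have "\<exists>r'. records ?L' \<nu> = Some r' \<and> j \<in> {1..r_budget r'}"
      if "slots ?L' (\<nu>, j) = Some y" for \<nu> j y
    proof (cases "\<nu> = r_id r")
      case True
      with that no_slot J show ?thesis
        by (auto simp: add_record_def split: if_splits)
    next
      case False
      with that wf show ?thesis
        by (auto simp: add_record_def well_formed_def)
    qed
    ultimately show ?thesis
      using wf by (simp add: well_formed_def) (simp add: add_record_def)
  qed
  ultimately show ?thesis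
    by (simp add: extends_def)
qed

section \<open>Slots and keys read off a trace\<close>

definition prepared_slots :: "('a, 'g) event list \<Rightarrow> (rec_id \<times> nat) list" where
  "prepared_slots = concat \<circ> map (\<lambda>ev. case ev of
      Prepare p q m c \<gamma> j k \<Rightarrow> [(r_id (fst m), j)]
    | _ \<Rightarrow> [])"

definition effects :: "('a, 'g) event list \<Rightarrow> ((rec_id \<times> nat) \<times> key) list" where
  "effects = concat \<circ> map (\<lambda>ev. case ev of Effect \<nu> j k \<Rightarrow> [((\<nu>, j), k)] | _ \<Rightarrow> [])"

lemma set_effects: "((\<nu>, j), k) \<in> set (effects \<tau>) \<longleftrightarrow> Effect \<nu> j k \<in> set \<tau>"
  by (induction \<tau>) (auto simp: effects_def split: event.split)

text \<open>Turns counts over events into counts over \<open>effects\<close>. The predicate is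
  arbitrary because it is used both for a fixed key and for the records of an instance.\<close>

lemma length_filter_effects:
  "length (filter (\<lambda>ev. case ev of Effect \<nu> j k \<Rightarrow> P \<nu> j k | _ \<Rightarrow> False) \<tau>) =
    length (filter (\<lambda>((\<nu>, j), k). P \<nu> j k) (effects \<tau>))"
  by (induction \<tau>) (auto simp: effects_def split: event.split)

text \<open>Idempotency bounds the multiplicity of each key among the effects by one, and a list
  with all multiplicities at most one is distinct.\<close>

lemma sink_idempotent_distinct:
  assumes "sink_idempotent \<tau>"
  shows "distinct (map snd (effects \<tau>))"
proof -
  have "count_list (map snd (effects \<tau>)) k \<le> 1" for k
  proof -
    have "count_list (map snd xs) k = length (filter (\<lambda>((\<nu>, j), k'). k' = k) xs)"
      for xs :: "((rec_id \<times> nat) \<times> key) list"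
      by (induction xs) auto
    then show ?thesis
      using assms by (simp add: sink_idempotent_def length_filter_effects)
  qed
  moreover have "distinct ks" if "\<And>k. count_list ks k \<le> 1" for ks :: "key list"
    using that
  proof (induction ks)
    case (Cons k ks)
    have "count_list ks k' \<le> 1" for k'
      using Cons.prems [of k'] by (auto split: if_splits)
    moreover have "k \<notin> set ks"
      using Cons.prems [of k] by (simp add: count_list_0_iff)
    ultimately show ?case
      using Cons.IH by simp
  qed simp
  ultimately show ?thesis
    by blast
qed

section \<open>Invariants of runs over a reliable ledger\<close>

locale reliable_ledger =
  fixes E :: "('a, 'g, 'm, 's) env"
  assumes durable: "ledger_durable E" and non_rollback: "ledger_non_rollback E"
    and linearizable: "ledger_linearizable E"
begin

abbreviation content :: "'s state \<Rightarrow> ledger" where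
  "content s \<equiv> ledger_content E (store s)"

lemma readD: "ledger_read E st v \<Longrightarrow> v = ledger_content E st"
  and txnD: "ledger_txn E st v v' st' \<Longrightarrow> v = ledger_content E st \<and> ledger_content E st' = v'"
  using linearizable by (auto simp: ledger_linearizable_def)

lemma crashD: "ledger_crash E st st' \<Longrightarrow> ledger_content E st' = ledger_content E st"
  using durable by (simp add: ledger_durable_def)

lemma maintD: "ledger_maint E st st' \<Longrightarrow> ledger_content E st' = ledger_content E st"
  using non_rollback by (simp add: ledger_non_rollback_def)

text \<open>Linearizability makes the view of each transaction the current content. Preparing,
  revoking and delegating start from \<open>Issued\<close> slots, which carry no key; committing
  keeps the key \<open>k\<close> it finds.\<close>

lemma step_extends:
  assumes "step E s ev s'" and "well_formed (content s)"
  shows "extends (content s) (content s')"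
  using assms
proof (induction rule: step.induct)
  case (issue c \<gamma> r v J st)
  from txnD [OF issue(3)] issue extends_add_record [of "content s" r J] show ?case
    by simp
next
  case (delegate p q m h J v st)
  from txnD [OF delegate(6)] delegate extends_reserve [of J "content s" "r_id h" "fst m"] show ?case
    by simp
next
  case prepare
  then show ?case
    by (auto dest!: txnD intro!: extends_set_slot simp: slot_key_def)
next
  case recover_commit
  then show ?case
    by (auto dest!: txnD intro!: extends_set_slot simp: slot_key_def)
next
  case commit
  then show ?case
    by (auto dest!: txnD intro!: extends_set_slot simp: slot_key_def)
next
  case revoke
  then show ?case
    by (auto dest!: txnD intro!: extends_set_slot simp: slot_key_def)
qed (auto dest: crashD maintD)

lemma run_well_formed: "run E \<tau> s \<Longrightarrow> well_formed (content s)"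
proof (induction rule: run.induct)
  case (start s)
  then show ?case
    by (simp add: initial_def well_formed_empty)
next
  case (extend \<tau> s ev s')
  then show ?case
    using step_extends by (auto simp: extends_def)
qed

lemma step_key_mono:
  "\<lbrakk>run E \<tau> s; step E s ev s'; slot_key (content s) x = Some k\<rbrakk> \<Longrightarrow> slot_key (content s') x = Some k"
  using step_extends run_well_formed unfolding extends_def map_le_def by (metis domI)

lemma step_record_mono:
  "\<lbrakk>run E \<tau> s; step E s ev s'; records (content s) \<nu> = Some r\<rbrakk> \<Longrightarrow> records (content s') \<nu> = Some r"
  using step_extends run_well_formed unfolding extends_def map_le_def by (metis domI)

lemma step_IssueD:
  assumes "step E s (Issue c \<gamma> r J) s'"
  shows "records (content s') (r_id r) = Some r" and "J \<subseteq> {1..r_budget r}"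
    and "\<forall>r' \<in> ran (records (content s)). (r_action r', r_conf r') \<noteq> (r_action r, r_conf r)"
  using assms by (auto elim!: step.cases dest!: txnD simp: add_record_def)

lemma run_Issue_record:
  "run E \<tau> s \<Longrightarrow> Issue c \<gamma> r J \<in> set \<tau> \<Longrightarrow> records (content s) (r_id r) = Some r"
proof (induction rule: run.induct)
  case (extend \<tau> s ev s')
  then show ?case
    using step_record_mono step_IssueD(1) by (cases "ev = Issue c \<gamma> r J") auto
qed simp

text \<open>Passes from the trace to the present ledger: a record once inserted is neither removed
  nor replaced.\<close>

lemma run_record_of:
  assumes "run E \<tau> s" and "record_of \<alpha> \<tau> \<nu>"
  obtains r where "records (content s) \<nu> = Some r" and "instance_of r = \<alpha>"
  using assms run_Issue_record unfolding record_of_def by blast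

section \<open>Counting the slots of one instance\<close>

text \<open>Records of the same instance agree in action and confirmation, hence coincide by
  uniqueness in the ledger, and a record determines its identifier.\<close>

lemma record_of_unique:
  assumes "run E \<tau> s" and "record_of \<alpha> \<tau> \<nu>" and "record_of \<alpha> \<tau> \<nu>'"
  shows "\<nu> = \<nu>'"
proof -
  obtain r r' where r: "records (content s) \<nu> = Some r" "instance_of r = \<alpha>"
    and r': "records (content s) \<nu>' = Some r'" "instance_of r' = \<alpha>"
    using assms run_record_of by metis
  then have "(r_action r, r_conf r) = (r_action r', r_conf r')"
    by (auto simp: instance_of_def)
  moreover have "r \<in> ran (records (content s))" "r' \<in> ran (records (content s))"
    using r r' by (auto intro: ranI)
  ultimately have "r = r'"
    using run_well_formed [OF assms(1)] unfolding well_formed_def inj_on_def by blast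
  with r(1) r'(1) show ?thesis
    using run_well_formed [OF assms(1)] unfolding well_formed_def by metis
qed

lemma record_of_slot_bound:
  assumes "run E \<tau> s" and "record_of \<alpha> \<tau> \<nu>" and "slot_key (content s) (\<nu>, j) = Some k"
  shows "j \<in> {1..budget \<alpha>}"
proof -
  obtain r where r: "records (content s) \<nu> = Some r" "instance_of r = \<alpha>"
    using assms run_record_of by metis
  then have "r_budget r = budget \<alpha>"
    by (auto simp: instance_of_def budget_def)
  with r run_well_formed [OF assms(1)] slot_key_SomeD [OF assms(3)] show ?thesis
    unfolding well_formed_def by fastforce
qed

text \<open>The pigeonhole argument shared by admission and effects.\<close>

lemma slot_count_bound:
  assumes "run E \<tau> s" and "distinct xs"
    and xs: "\<And>\<nu> j. (\<nu>, j) \<in> set xs \<Longrightarrow> record_of \<alpha> \<tau> \<nu> \<and> (\<exists>k. slot_key (content s) (\<nu>, j) = Some k)"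
  shows "length xs \<le> budget \<alpha>"
proof (cases xs)
  case (Cons x xs')
  \<comment> \<open>The head of the list serves only to name the record identifier; uniqueness
    forces all other entries to share it.\<close>
  have "set xs \<subseteq> {fst x} \<times> {1..budget \<alpha>}"
  proof
    fix y assume y: "y \<in> set xs"
    have "record_of \<alpha> \<tau> (fst x)"
      using xs [of "fst x" "snd x"] Cons by simp
    moreover obtain k where "record_of \<alpha> \<tau> (fst y)" "slot_key (content s) (fst y, snd y) = Some k"
      using xs [of "fst y" "snd y"] y by auto
    ultimately have "fst y = fst x" "snd y \<in> {1..budget \<alpha>}"
      using record_of_unique record_of_slot_bound assms(1) by blast+
    then show "y \<in> {fst x} \<times> {1..budget \<alpha>}"
      by (simp add: mem_Times_iff)
  qed
  then have "card (set xs) \<le> card ({fst x} \<times> {1..budget \<alpha>})"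
    by (intro card_mono) auto
  then show ?thesis
    using assms(2) by (simp add: distinct_card card_cartesian_product)
qed simp

section \<open>Bounded issuance\<close>

text \<open>The bound is sharpened to 0 as long as the ledger holds no record of
  \<open>\<alpha>\<close>. This carries the induction: an issue for \<open>\<alpha>\<close> happens
  only in that situation, so its slots are added to 0.\<close>

lemma N_issue_bound:
  "run E \<tau> s \<Longrightarrow>
    N_issue \<alpha> \<tau> \<le> (if \<alpha> \<in> instance_of ` ran (records (content s)) then budget \<alpha> else 0)"
proof (induction rule: run.induct)
  case (start s)
  then show ?case
    by (simp add: N_issue_def)
next
  case (extend \<tau> s ev s')
  have mono: "ran (records (content s)) \<subseteq> ran (records (content s'))"
    using step_record_mono [OF extend.hyps] by (auto simp: ran_def)
  show ?case
  proof (cases "\<exists>c \<gamma> r J. ev = Issue c \<gamma> r J \<and> instance_of r = \<alpha>")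
    case True
    then obtain c \<gamma> r J where ev: "ev = Issue c \<gamma> r J" and r: "instance_of r = \<alpha>"
      by blast
    note issue = step_IssueD [OF extend.hyps(2) [unfolded ev]]
    \<comment> \<open>The uniqueness check excludes every record with this action and confirmation,
      in particular every record of \<open>\<alpha>\<close>.\<close>
    have "\<alpha> \<notin> instance_of ` ran (records (content s))"
      using issue(3) r by (auto simp: instance_of_def)
    then have "N_issue \<alpha> \<tau> = 0"
      using extend.IH by simp
    then have "N_issue \<alpha> (\<tau> @ [ev]) = card J"
      using r by (simp add: N_issue_def ev)
    also have "\<dots> \<le> budget \<alpha>"
      using card_mono [OF _ issue(2)] r by (auto simp: instance_of_def budget_def)
    finally show ?thesis
      using issue(1) r by (auto intro: ranI)
  next
    case False
    then have "N_issue \<alpha> (\<tau> @ [ev]) = N_issue \<alpha> \<tau>"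
      by (auto simp: N_issue_def split: event.split)
    then show ?thesis
      using extend.IH mono by (auto split: if_splits)
  qed
qed

section \<open>Bounded admission\<close>

lemma step_PrepareD:
  assumes "step E s (Prepare p q m c \<gamma> j k) s'"
  shows "slot_key (content s) (r_id (fst m), j) = None"
    and "slot_key (content s') (r_id (fst m), j) = Some k"
  using assms by (auto elim!: step.cases dest!: txnD simp: slot_key_def set_slot_def)

text \<open>The two halves support each other: slots prepared earlier still have a key, whereas a
  slot about to be prepared has none, so it is new to the list.\<close>

lemma run_prepared_slots:
  "run E \<tau> s \<Longrightarrow> distinct (prepared_slots \<tau>) \<and>
    (\<forall>x \<in> set (prepared_slots \<tau>). \<exists>k. slot_key (content s) x = Some k)"
proof (induction rule: run.induct)
  case (start s)
  then show ?case
    by (simp add: prepared_slots_def)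
next
  case (extend \<tau> s ev s')
  have old: "\<forall>x \<in> set (prepared_slots \<tau>). \<exists>k. slot_key (content s') x = Some k"
    using extend.IH step_key_mono [OF extend.hyps] by blast
  show ?case
  proof (cases "\<exists>p q m c \<gamma> j k. ev = Prepare p q m c \<gamma> j k")
    case True
    then obtain p q m c \<gamma> j k where ev: "ev = Prepare p q m c \<gamma> j k"
      by blast
    note prepare = step_PrepareD [OF extend.hyps(2) [unfolded ev]]
    have "prepared_slots (\<tau> @ [ev]) = prepared_slots \<tau> @ [(r_id (fst m), j)]"
      by (simp add: prepared_slots_def ev)
    moreover have "(r_id (fst m), j) \<notin> set (prepared_slots \<tau>)"
      using extend.IH prepare(1) by fastforce
    ultimately show ?thesis
      using extend.IH old prepare(2) by auto
  next
    case False
    then have "prepared_slots (\<tau> @ [ev]) = prepared_slots \<tau>"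
      by (auto simp: prepared_slots_def split: event.split)
    then show ?thesis
      using extend.IH old by simp
  qed
qed

lemma N_admit_bound:
  assumes "run E \<tau> s"
  shows "N_admit \<alpha> \<tau> \<le> budget \<alpha>"
proof -
  let ?xs = "filter (\<lambda>x. record_of \<alpha> \<tau> (fst x)) (prepared_slots \<tau>)"
  \<comment> \<open>Stated for arbitrary \<open>P\<close> and \<open>\<tau>'\<close>, since
    \<open>record_of \<alpha> \<tau>\<close> refers to the whole trace and must stay fixed while the
    filtered list shrinks in the induction.\<close>
  have "length (filter (\<lambda>ev. case ev of Prepare p q m c \<gamma> j k \<Rightarrow> P (r_id (fst m)) | _ \<Rightarrow> False) \<tau>') =
      length (filter (\<lambda>x. P (fst x)) (prepared_slots \<tau>'))" for P and \<tau>' :: "('a, 'g) event list"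
    by (induction \<tau>') (auto simp: prepared_slots_def split: event.split)
  then have "N_admit \<alpha> \<tau> = length ?xs"
    by (simp add: N_admit_def)
  also have "\<dots> \<le> budget \<alpha>"
    using assms run_prepared_slots [OF assms] by (intro slot_count_bound) auto
  finally show ?thesis .
qed

section \<open>Bounded effects\<close>

text \<open>A new invocation finds its slot in state \<open>Prepared k\<close>. A recovery may
  commit the slot in the same step, but \<open>Committed k\<close> still carries \<open>k\<close>,
  so the key can be read off the content after the step.\<close>

lemma step_invoked_key:
  assumes "step E s ev s'" and "(\<nu>, j, k) \<in> invoked s'"
  shows "(\<nu>, j, k) \<in> invoked s \<or> slot_key (content s') (\<nu>, j) = Some k"
  using assms by (auto elim!: step.cases dest!: txnD readD simp: slot_key_def set_slot_def)

lemma run_invoked_key: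
  "run E \<tau> s \<Longrightarrow> (\<nu>, j, k) \<in> invoked s \<Longrightarrow> slot_key (content s) (\<nu>, j) = Some k"
proof (induction rule: run.induct)
  case (start s)
  then show ?case
    by (simp add: initial_def)
next
  case (extend \<tau> s ev s')
  then show ?case
    using step_invoked_key step_key_mono by blast
qed

text \<open>An effect may occur long after its invocation, but the key found at the invocation stays
  with the slot for the rest of the run.\<close>

lemma run_Effect_key:
  "run E \<tau> s \<Longrightarrow> Effect \<nu> j k \<in> set \<tau> \<Longrightarrow> slot_key (content s) (\<nu>, j) = Some k"
proof (induction rule: run.induct)
  case (extend \<tau> s ev s')
  show ?case
  proof (cases "ev = Effect \<nu> j k")
    case True
    with extend.hyps(2) have "(\<nu>, j, k) \<in> invoked s"
      by (auto elim: step.cases)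
    then show ?thesis
      using extend.hyps run_invoked_key step_key_mono by blast
  next
    case False
    with extend show ?thesis
      using step_key_mono by auto
  qed
qed simp

lemma N_effect_bound:
  assumes run: "run E \<tau> s" and "sink_idempotent \<tau>"
  shows "N_effect \<alpha> \<tau> \<le> budget \<alpha>"
proof -
  let ?xs = "filter (\<lambda>((\<nu>, j), k). record_of \<alpha> \<tau> \<nu>) (effects \<tau>)"
  have key: "slot_key (content s) (fst x) = Some (snd x)" if "x \<in> set (effects \<tau>)" for x
    using that run_Effect_key [OF run] set_effects by (metis prod.collapse)
  have "distinct (effects \<tau>)"
    using sink_idempotent_distinct [OF assms(2)] by (simp add: distinct_map)
  \<comment> \<open>The final content gives each slot a single key, so effects of the same slot
    coincide as pairs; since the pairs are distinct, so are their slots.\<close>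
  moreover have "inj_on fst (set (effects \<tau>))"
    using key by (intro inj_onI) (metis option.inject prod.expand)
  ultimately have "distinct (map fst ?xs)"
    by (auto simp: distinct_map intro: inj_on_subset)
  then have "length (map fst ?xs) \<le> budget \<alpha>"
    using run key by (intro slot_count_bound) fastforce+
  then show ?thesis
    by (simp add: N_effect_def length_filter_effects)
qed

end

theorem proposition1:
  fixes E :: "('a, 'g, 'm, 's) env"
  assumes "canonicalization_correct E" and "trusted_metadata_correct E"
    and "confirmations_stable E"
    and "ledger_durable E" and "ledger_non_rollback E" and "ledger_linearizable E"
    and "principals_authenticated E" and "manifests_authenticated E"
  shows "(\<forall>(\<tau> :: ('a, 'g) event list) (\<alpha> :: instance_id). caplease_trace E \<tau> \<longrightarrow>
            N_issue \<alpha> \<tau> \<le> budget \<alpha> \<and> N_admit \<alpha> \<tau> \<le> budget \<alpha>)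
       \<and> (\<forall>(\<tau> :: ('a, 'g) event list) (\<alpha> :: instance_id). caplease_trace E \<tau> \<longrightarrow> sink_idempotent \<tau> \<longrightarrow>
            N_effect \<alpha> \<tau> \<le> budget \<alpha>)"
proof -
  interpret reliable_ledger E
    using assms by unfold_locales
  show ?thesis
  proof (intro conjI allI impI; unfold caplease_trace_def; elim exE)
    fix \<tau> :: "('a, 'g) event list" and \<alpha> s
    assume run: "run E \<tau> s"
    show "N_issue \<alpha> \<tau> \<le> budget \<alpha>"
      using N_issue_bound [OF run, of \<alpha>] by (simp split: if_splits)
    show "N_admit \<alpha> \<tau> \<le> budget \<alpha>"
      using run by (rule N_admit_bound)
    show "N_effect \<alpha> \<tau> \<le> budget \<alpha>" if "sink_idempotent \<tau>"
      using run that by (rule N_effect_bound)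
  qed
qed

end
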